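(* Let $A\in\mathbb R^{2n\times 2n}$ be symmetric positive definite. If Algorithm $W_2$ applied to $A$ in floating-point arithmetic with machine precision $u$ runs to completion, then the computed block triangular factor $\tilde L_2\in\mathbb R^{2n\times 2n}$ satisfies $$A+E=\tilde L_2\tilde L_2^T,\qquad |E|\le u\,|A|+\gamma_{n+1}(u)\,|\tilde L_2|\,|\tilde L_2^T|.$$ Moreover, the factorization error satisfies the normwise bound $$\|A-\tilde L_2\tilde L_2^T\|_2=\|E\|_2\le 4n\,\gamma_{n+2}(u)\,\|A\|_2,$$ provided that $4n\,\gamma_{n+2}(u)<1$.
   Context: For a real matrix $B=(b_{ij})$, $|B|=(|b_{ij}|)$, and inequalities between matrices are componentwise; $\|\cdot\|_2$ is the spectral norm. $\gamma_k(u)=\frac{ku}{1-ku}$ for $ku<1$. Floating-point computations follow the standard model: each operation $\mathrm{op}\in\{+,-,\times,/\}$ satisfies $\mathrm{fl}(x\ \mathrm{op}\ y)=(x\ \mathrm{op}\ y)(1+\delta)$ with $|\delta|\le u$, similarly for square roots, and no overflow or underflow occurs. Write $$A=\begin{pmatrix}A_{11}&A_{12}\\ A_{12}^T&A_{22}\end{pmatrix},\qquad A_{11},A_{12},A_{22}\in\mathbb R^{n\times n}.$$ The Cholesky factorization of a symmetric positive definite $M$ is $M=LL^T$ with $L$ lower triangular with positive diagonal. The Reverse Cholesky factorization is $M=UU^T$ with $U$ upper triangular with positive diagonal; it is obtained by Cholesky-factorizing $P^TMP=LL^T$, where $P$ is the identity matrix with its columns in reverse order, and setting $U=PLP^T$.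 Algorithm $W_2$ (applied to a symmetric positive definite $A$, not necessarily symplectic): 1. compute the Cholesky factorization $A_{11}=L_{11}L_{11}^T$; 2. solve $L_{11}L_{21}^T=A_{12}$ for $L_{21}$ by forward substitution; 3. compute $S=A_{22}-L_{21}L_{21}^T$ (the product by standard matrix multiplication, then the subtraction; the result is symmetric); 4. compute the Reverse Cholesky factorization $S=U_{22}U_{22}^T$; 5. set $L_{22}=U_{22}$. The output is $L_2=\begin{pmatrix}L_{11}&0\\ L_{21}&L_{22}\end{pmatrix}$. Tildes denote the quantities actually computed in floating-point arithmetic. *)

theory Defs
  imports "HOL-Analysis.Analysis" "HOL-Library.Multiset"
begin

text \<open>
  An \<open>n \<times> n\<close> matrix has type \<open>real ^ 'n ^ 'n\<close> with \<open>n = CARD('n)\<close>, where the linear order of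
  \<open>'n\<close> plays the role of the order of the row and column numbers \<open>1, \<dots>, n\<close>. A \<open>2n \<times> 2n\<close> matrix is
  indexed by \<open>'n + 'n\<close>: the first \<open>n\<close> indices are \<open>Inl i\<close>, the last \<open>n\<close> are \<open>Inr i\<close>.
  On these types \<open>\<bar>B\<bar>\<close> and \<open>B \<le> C\<close> are the componentwise notions of the library.
\<close>

type_synonym 'n sqmat = "real^'n^'n"

definition block_matrix ::
  "'n sqmat \<Rightarrow> 'n sqmat \<Rightarrow> 'n sqmat \<Rightarrow> 'n sqmat \<Rightarrow> real^('n::finite + 'n)^('n + 'n)" where
  "block_matrix B11 B12 B21 B22 =
     (\<chi> i j. case i of
        Inl a \<Rightarrow> (case j of Inl b \<Rightarrow> B11 $ a $ b | Inr b \<Rightarrow> B12 $ a $ b)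
      | Inr a \<Rightarrow> (case j of Inl b \<Rightarrow> B21 $ a $ b | Inr b \<Rightarrow> B22 $ a $ b))"

definition sym_pos_def :: "real^'m^'m \<Rightarrow> bool" where
  "sym_pos_def B \<longleftrightarrow> transpose B = B \<and> (\<forall>x. x \<noteq> 0 \<longrightarrow> 0 < x \<bullet> (B *v x))"

definition spectral_norm :: "real^'m^'k \<Rightarrow> real" where
  "spectral_norm B = onorm ((*v) B)"

definition lower_triangular :: "('n::{finite,linorder}) sqmat \<Rightarrow> bool" where
  "lower_triangular L \<longleftrightarrow> (\<forall>i j. i < j \<longrightarrow> L $ i $ j = 0)"

definition gamma :: "nat \<Rightarrow> real \<Rightarrow> real" where
  "gamma k u = real k * u / (1 - real k * u)"

text \<open>
  \<open>rev_index\<close> sends the \<open>k\<close>-th smallest index to the \<open>k\<close>-th largest one.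
\<close>

definition rev_index :: "'n::{finite,linorder} \<Rightarrow> 'n" where
  "rev_index i = (THE j. card {k. j < k} = card {k. k < i})"

definition rev_identity :: "('n::{finite,linorder}) sqmat" where
  "rev_identity = (\<chi> i j. mat 1 $ i $ rev_index j)"

lemma rev_index_strict_antimono:
  fixes i j :: "'n::{finite,linorder}"
  assumes "i < j"
  shows "rev_index j < rev_index i"
proof -
  let ?f = "\<lambda>i::'n. card {k. k < i}" and ?g = "\<lambda>j::'n. card {k. j < k}"
  have f: "?f a < ?f b" if "a < b" for a b
    using that by (intro psubset_card_mono) auto
  have g: "?g b < ?g a" if "a < b" for a b
    using that by (intro psubset_card_mono) auto
  have inj: "inj ?f" "inj ?g"
    by (rule injI; rule ccontr; use f g in \<open>force simp: neq_iff\<close>)+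
  have less: "?f a < CARD('n)" "?g a < CARD('n)" for a
    by (rule psubset_card_mono; force)+
  have "range ?f = {..<CARD('n)}" "range ?g = {..<CARD('n)}"
    by (rule card_subset_eq; use less inj in \<open>auto simp: card_image\<close>)+
  then have "\<exists>!j. ?g j = ?f i" for i
    using inj(2) by (metis (no_types, lifting) injD rangeE rangeI)
  then have r: "?g (rev_index i) = ?f i" for i
    unfolding rev_index_def by (rule theI')
  show ?thesis
    using f[OF assms] g r by (metis linorder_less_linear not_less_iff_gr_or_eq)
qed

text \<open>
  Floating-point computation is modelled by relations: \<open>fl_round u x y\<close> says that \<open>y\<close> is an
  admissible computed value of an elementary operation whose exact result is \<open>x\<close>. Every occurrence
  of an operation has its own rounding error \<open>\<delta>\<close>.
\<close>

definition fl_round :: "real \<Rightarrow> real \<Rightarrow> real \<Rightarrow> bool" where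
  "fl_round u x y \<longleftrightarrow> (\<exists>\<delta>. \<bar>\<delta>\<bar> \<le> u \<and> y = x * (1 + \<delta>))"

text \<open>
  \<open>fl_sum u X s\<close>: \<open>s\<close> can be obtained by adding up the terms in \<open>X\<close> in floating-point arithmetic, in
  some order and with some bracketing.
\<close>

inductive fl_sum :: "real \<Rightarrow> real multiset \<Rightarrow> real \<Rightarrow> bool" for u where
  single: "fl_sum u {#x#} x"
| plus: "fl_sum u X s \<Longrightarrow> fl_sum u Y t \<Longrightarrow> fl_round u (s + t) r \<Longrightarrow> fl_sum u (X + Y) r"

definition fl_inner :: "real \<Rightarrow> 'k set \<Rightarrow> ('k \<Rightarrow> real) \<Rightarrow> ('k \<Rightarrow> real) \<Rightarrow> real \<Rightarrow> bool" where
  "fl_inner u K a b s \<longleftrightarrow>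
     (\<exists>p. (\<forall>k\<in>K. fl_round u (a k * b k) (p k)) \<and> fl_sum u (image_mset p (mset_set K)) s)"

text \<open>
  \<open>fl_residual u c K a b s\<close>: \<open>s\<close> is a computed value of \<open>c - (\<Sum>k\<in>K. a k * b k)\<close>. Subtraction is
  addition of the negated term; since changing a sign is exact, this covers successive subtraction
  of the products from \<open>c\<close> as well as subtraction of their computed sum.
\<close>

definition fl_residual ::
  "real \<Rightarrow> real \<Rightarrow> 'k set \<Rightarrow> ('k \<Rightarrow> real) \<Rightarrow> ('k \<Rightarrow> real) \<Rightarrow> real \<Rightarrow> bool" where
  "fl_residual u c K a b s \<longleftrightarrow>
     (\<exists>p. (\<forall>k\<in>K. fl_round u (a k * b k) (p k)) \<and>
          fl_sum u (add_mset c (image_mset (\<lambda>k. - p k) (mset_set K))) s)"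

text \<open>
  The following relations hold between the input and the computed output of a run that is carried out
  to completion. A Cholesky factorization breaks down at a computed pivot \<open>s \<le> 0\<close>. For \<open>u < 1\<close> a
  positive pivot makes the computed diagonal entry positive, so no division by zero occurs.
\<close>

definition fl_cholesky :: "real \<Rightarrow> ('n::{finite,linorder}) sqmat \<Rightarrow> 'n sqmat \<Rightarrow> bool" where
  "fl_cholesky u M L \<longleftrightarrow>
     lower_triangular L \<and>
     (\<forall>j. \<exists>s. fl_residual u (M $ j $ j) {k. k < j} (\<lambda>k. L $ j $ k) (\<lambda>k. L $ j $ k) s \<and>
              0 < s \<and> fl_round u (sqrt s) (L $ j $ j)) \<and>
     (\<forall>i j. j < i \<longrightarrow>
        (\<exists>s. fl_residual u (M $ i $ j) {k. k < j} (\<lambda>k. L $ i $ k) (\<lambda>k. L $ j $ k) s \<and>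
             fl_round u (s / L $ j $ j) (L $ i $ j)))"

definition fl_rev_cholesky :: "real \<Rightarrow> ('n::{finite,linorder}) sqmat \<Rightarrow> 'n sqmat \<Rightarrow> bool" where
  "fl_rev_cholesky u M U \<longleftrightarrow>
     (\<exists>L. fl_cholesky u (transpose rev_identity ** M ** rev_identity) L \<and>
          U = rev_identity ** L ** transpose rev_identity)"

text \<open>\<open>fl_forward_subst u L B X\<close>: \<open>X\<close> is a computed solution of \<open>L ** X = B\<close>.\<close>

definition fl_forward_subst ::
  "real \<Rightarrow> ('n::{finite,linorder}) sqmat \<Rightarrow> (real^'m, 'n) vec \<Rightarrow> (real^'m, 'n) vec \<Rightarrow> bool" where
  "fl_forward_subst u L B X \<longleftrightarrow>
     (\<forall>i j. \<exists>s. fl_residual u (B $ i $ j) {k. k < i} (\<lambda>k. L $ i $ k) (\<lambda>k. X $ k $ j) s \<and>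
                fl_round u (s / L $ i $ i) (X $ i $ j))"

definition fl_matrix_mult :: "real \<Rightarrow> real^'k^'m \<Rightarrow> real^'n^'k \<Rightarrow> real^'n^'m \<Rightarrow> bool" where
  "fl_matrix_mult u B C D \<longleftrightarrow>
     (\<forall>i j. fl_inner u UNIV (\<lambda>k. B $ i $ k) (\<lambda>k. C $ k $ j) (D $ i $ j))"

definition fl_matrix_minus :: "real \<Rightarrow> real^'n^'m \<Rightarrow> real^'n^'m \<Rightarrow> real^'n^'m \<Rightarrow> bool" where
  "fl_matrix_minus u B C D \<longleftrightarrow> (\<forall>i j. fl_round u (B $ i $ j - C $ i $ j) (D $ i $ j))"

text \<open>
  Since the rounding errors of different entries are unrelated, the symmetry of the computed Schur
  complement \<open>S\<close> is stated explicitly; it says that \<open>S $ i $ j\<close> and \<open>S $ j $ i\<close> are computed in the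
  same way, or only once.
\<close>

definition fl_algorithm_W2 ::
  "real \<Rightarrow> real^('n + 'n)^('n + 'n) \<Rightarrow> real^('n::{finite,linorder} + 'n)^('n + 'n) \<Rightarrow> bool" where
  "fl_algorithm_W2 u A L2 \<longleftrightarrow>
     (\<exists>A11 A12 A22 L11 L21 C S U22 L22.
        A = block_matrix A11 A12 (transpose A12) A22 \<and>
        fl_cholesky u A11 L11 \<and>
        fl_forward_subst u L11 A12 (transpose L21) \<and>
        fl_matrix_mult u L21 (transpose L21) C \<and>
        fl_matrix_minus u A22 C S \<and>
        transpose S = S \<and>
        fl_rev_cholesky u S U22 \<and>
        L22 = U22 \<and>
        L2 = block_matrix L11 0 L21 L22)"

end

theory Submission
  imports Defs
begin

text \<open>
  The entrywise bound is a backward error analysis. Every entry of \<open>L11\<close>, \<open>L21\<close> and \<open>U22\<close>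
  comes from evaluating some \<open>c - (\<Sum>k\<in>K. a k * b k)\<close> and then dividing or taking a square root.
  Following the rounding errors backwards, the relation that defines the entry holds exactly once
  each term, except \<open>c\<close> itself, is multiplied by a product of a bounded number of factors
  \<open>1 + \<delta>\<close> or their inverses; such a product differs from \<open>1\<close> by at most \<open>gamma\<close> of their number
  (\<open>rounding_factor_gamma\<close>). The essential point is
  \<open>fl_residual_backward_error\<close>: no perturbation falls on \<open>c\<close>, and the number of factors is as
  small as stated whatever the order of summation. This bounds the errors in the blocks
  \<open>A11\<close> and \<open>A12\<close> by \<open>gamma\<close> times entries of \<open>\<bar>L2\<bar> ** \<bar>transpose L2\<bar>\<close> alone. In the block \<open>A22\<close>
  the errors of the product, of the subtraction and of the reverse factorization add up. The
  subtraction is the only place where the data itself is perturbed, which gives the term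
  \<open>u *\<^sub>R \<bar>A\<bar>\<close>; its effect on the product is absorbed by raising the index of \<open>gamma\<close> by one
  (\<open>gamma_add_le\<close>).

  For the normwise bound, let \<open>e\<close> and \<open>a\<close> be the spectral norms of \<open>E\<close> and \<open>A\<close>, and \<open>g\<close> the
  value of \<open>gamma\<close> in the entrywise bound. By the inequality of the arithmetic
  and geometric means, applied termwise, an entry of \<open>\<bar>L2\<bar> ** \<bar>transpose L2\<bar>\<close> is at most the mean of
  two diagonal entries of \<open>L2 ** transpose L2 = A + E\<close>, hence
  at most \<open>a + e\<close>. So all entries of \<open>E\<close> are at most \<open>u * a + g * (a + e)\<close>, and the spectral norm
  of a matrix of order \<open>2 * n\<close> is at most \<open>2 * n\<close> times its largest entry. The smallness
  assumption gives \<open>2 * n * g \<le> 1 / 2\<close>, so \<open>e\<close> can be moved to the left-hand side at the cost of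
  a factor \<open>2\<close>, and \<open>u + g\<close> is at most the next value of \<open>gamma\<close>.
\<close>

section \<open>Accumulated rounding errors\<close>

text \<open>
  A stand-in for "\<open>r\<close> is a product of \<open>n\<close> factors, each of the form \<open>1 + \<delta>\<close> or \<open>1 / (1 + \<delta>)\<close>
  with \<open>\<bar>\<delta>\<bar> \<le> u\<close>": for \<open>u < 1\<close> it is the interval from \<open>(1 - u) ^ n\<close> to its reciprocal. The interval
  is closed under the operations needed below, and inversion is as cheap as multiplication.
\<close>

definition rounding_factor :: "real \<Rightarrow> nat \<Rightarrow> real \<Rightarrow> bool" where
  "rounding_factor u n r \<longleftrightarrow> (1 - u) ^ n \<le> r \<and> r * (1 - u) ^ n \<le> 1"

lemma fl_round_factor:
  assumes "fl_round u x y" "0 \<le> u" "u < 1"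
  obtains r where "rounding_factor u 1 r" "y = x * r"
proof -
  from assms(1) obtain \<delta> where \<delta>: "\<bar>\<delta>\<bar> \<le> u" "y = x * (1 + \<delta>)"
    unfolding fl_round_def by blast
  have "(1 + \<delta>) * (1 - u) \<le> (1 + u) * (1 - u)"
    using \<delta> assms by (intro mult_right_mono) auto
  also have "\<dots> \<le> 1"
    by (simp add: algebra_simps)
  finally have "rounding_factor u 1 (1 + \<delta>)"
    using \<delta> by (auto simp: rounding_factor_def)
  with \<delta>(2) that show thesis by blast
qed

lemma rounding_factor_pos:
  assumes "rounding_factor u n r" "u < 1"
  shows "0 < r"
  using assms unfolding rounding_factor_def
  by (meson diff_gt_0_iff_gt less_le_trans zero_less_power)

lemma rounding_factor_one: "0 \<le> u \<Longrightarrow> u < 1 \<Longrightarrow> rounding_factor u n 1"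
  by (simp add: rounding_factor_def power_le_one)

lemma rounding_factor_mult:
  assumes "rounding_factor u m r" "rounding_factor u n s" "u < 1"
  shows "rounding_factor u (m + n) (r * s)"
proof -
  have pos: "0 < r" "0 < s"
    using assms rounding_factor_pos by blast+
  have "(1 - u) ^ (m + n) \<le> r * s"
    using assms pos unfolding rounding_factor_def power_add
    by (intro mult_mono) auto
  moreover have "(r * (1 - u) ^ m) * (s * (1 - u) ^ n) \<le> 1 * 1"
    using assms pos unfolding rounding_factor_def
    by (intro mult_mono) auto
  ultimately show ?thesis
    by (simp add: rounding_factor_def power_add ac_simps)
qed

lemma rounding_factor_inverse:
  assumes "rounding_factor u n r" "u < 1"
  shows "rounding_factor u n (inverse r)"
  using assms rounding_factor_pos[OF assms]
  by (simp add: rounding_factor_def field_simps)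

lemma rounding_factor_divide:
  assumes "rounding_factor u m r" "rounding_factor u n s" "u < 1"
  shows "rounding_factor u (m + n) (r / s)"
  using rounding_factor_mult[OF assms(1) rounding_factor_inverse[OF assms(2,3)] assms(3)]
  by (simp add: divide_inverse)

lemma rounding_factor_mono:
  assumes "rounding_factor u m r" "m \<le> n" "0 \<le> u" "u < 1"
  shows "rounding_factor u n r"
  using rounding_factor_mult[OF assms(1) rounding_factor_one[OF assms(3,4), of "n - m"] assms(4)]
    assms(2) by simp

lemma gamma_nonneg: "0 \<le> u \<Longrightarrow> real n * u < 1 \<Longrightarrow> 0 \<le> gamma n u"
  by (simp add: gamma_def)

text \<open>
  One further relative error \<open>u\<close>, committed on a quantity that already carries the relative error
  \<open>gamma n u\<close>, raises the index by one.
\<close>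

lemma gamma_add_le:
  assumes "0 \<le> u" "real (n + 1) * u < 1"
  shows "gamma n u + u * (1 + gamma n u) \<le> gamma (n + 1) u"
proof -
  have pos: "0 < 1 - real n * u" "0 < 1 - real (n + 1) * u"
    using assms by (auto simp: algebra_simps)
  have "1 + gamma n u = 1 / (1 - real n * u)"
    using pos by (simp add: gamma_def field_simps)
  then have "gamma n u + u * (1 + gamma n u) = real (n + 1) * u / (1 - real n * u)"
    by (simp add: gamma_def add_divide_distrib distrib_right)
  also have "\<dots> \<le> real (n + 1) * u / (1 - real (n + 1) * u)"
    using assms pos by (intro divide_left_mono mult_pos_pos) (auto simp: algebra_simps)
  finally show ?thesis
    by (simp add: gamma_def)
qed

text \<open>
  By Bernoulli's inequality the interval of rounding factors lies between \<open>1 - n * u\<close> and its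
  reciprocal, and \<open>1 / (1 - n * u) = 1 + gamma n u\<close>.
\<close>

lemma rounding_factor_gamma:
  assumes "rounding_factor u n r" "0 \<le> u" "real n * u < 1" "u < 1"
  shows "\<bar>r - 1\<bar> \<le> gamma n u"
proof -
  define q where "q = (1 - u) ^ n"
  have pos: "0 < 1 - real n * u"
    using assms by simp
  have q: "1 - real n * u \<le> q"
    using Bernoulli_inequality[of "- u" n] assms by (simp add: q_def)
  have r: "q \<le> r" "r * q \<le> 1" "0 < r"
    using assms rounding_factor_pos by (auto simp: rounding_factor_def q_def)
  have "r * (1 - real n * u) \<le> r * q"
    using q r by (intro mult_left_mono) auto
  then have "r * (1 - real n * u) \<le> 1"
    using r by linarith
  then have "r \<le> 1 / (1 - real n * u)"
    using pos by (simp add: pos_le_divide_eq)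
  also have "\<dots> = 1 + gamma n u"
    using pos by (simp add: gamma_def field_simps)
  finally have up: "r - 1 \<le> gamma n u" by simp
  have "real n * u * (1 - real n * u) \<le> real n * u * 1"
    using assms by (intro mult_left_mono) auto
  then have "real n * u \<le> gamma n u"
    using pos by (simp add: gamma_def pos_le_divide_eq)
  then show ?thesis
    using up q r by linarith
qed

section \<open>Sums and residuals\<close>

text \<open>
  An induction rule over the index set instead of the multiset of terms, so that error factors can be
  attached to indices even if several terms have the same value.
\<close>

lemma fl_sum_indexed_induct [consumes 2, case_names single plus]:
  assumes "fl_sum u (image_mset x (mset_set I)) s" "finite I"
    and single: "\<And>i. P {i} (x i)"
    and plus: "\<And>I J s t r. finite I \<Longrightarrow> finite J \<Longrightarrow> I \<noteq> {} \<Longrightarrow> J \<noteq> {} \<Longrightarrow> I \<inter> J = {} \<Longrightarrow>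
      fl_sum u (image_mset x (mset_set I)) s \<Longrightarrow> fl_sum u (image_mset x (mset_set J)) t \<Longrightarrow>
      P I s \<Longrightarrow> P J t \<Longrightarrow> fl_round u (s + t) r \<Longrightarrow> P (I \<union> J) r"
  shows "P I s"
proof -
  have nonempty: "X \<noteq> {#}" if "fl_sum u X s" for X s
    using that by induction auto
  have "P I s" if "fl_sum u X s" "X = image_mset x (mset_set I)" "finite I" for X I s
    using that
  proof (induction arbitrary: I)
    case (single y)
    then have "card I = 1"
      by (metis size_image_mset size_mset_set size_single)
    then obtain i where "I = {i}"
      by (auto simp: card_1_singleton_iff)
    with single assms(3) show ?case by simp
  next
    case (plus X s Y t r)
    from plus.prems(1) obtain B C where BC: "mset_set I = B + C" "X = image_mset x B" "Y = image_mset x C"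
      using image_mset_eq_plusD[of x "mset_set I" X Y] by metis
    have sets: "set_mset B \<union> set_mset C = I"
      using BC(1) plus.prems(2) by (metis finite_set_mset_mset_set set_mset_union)
    have count: "count B i + count C i \<le> 1" for i
      using BC(1) plus.prems(2) by (metis count_mset_set' count_union order_refl zero_le_one)
    have mset: "mset_set (set_mset B) = B" "mset_set (set_mset C) = C"
      using count by (auto simp: multiset_eq_iff count_mset_set' not_in_iff)
        (metis One_nat_def add_leD1 add_leD2 le_antisym count_greater_eq_one_iff)+
    have disj: "set_mset B \<inter> set_mset C = {}"
    proof (intro equalityI subsetI)
      fix i assume "i \<in> set_mset B \<inter> set_mset C"
      then have "0 < count B i" "0 < count C i"
        by auto
      with count[of i] show "i \<in> {}" by linarith
    qed simp
    have "P (set_mset B) s" "P (set_mset C) t"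
      using plus.IH mset BC by auto
    moreover have "B \<noteq> {#}" "C \<noteq> {#}"
      using nonempty[OF plus.hyps(1)] nonempty[OF plus.hyps(2)] BC by auto
    ultimately show ?case
      using assms(4)[OF _ _ _ _ disj _ _ _ _ plus.hyps(3)] sets plus.hyps mset BC by simp
  qed
  with assms(1,2) show ?thesis by blast
qed

text \<open>
  Adding up \<open>m\<close> terms takes \<open>m - 1\<close> additions, so a term takes part in at most that many of them,
  whatever the bracketing.
\<close>

lemma fl_sum_factors:
  assumes "fl_sum u (image_mset x (mset_set I)) s" "finite I" and u: "0 \<le> u" "u < 1"
  shows "\<exists>r. (\<forall>i\<in>I. rounding_factor u (card I - 1) (r i)) \<and> s = (\<Sum>i\<in>I. x i * r i)"
  using assms(1,2)
proof (induction rule: fl_sum_indexed_induct)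
  case (single i)
  show ?case
    by (rule exI[of _ "\<lambda>_. 1"]) (simp add: rounding_factor_one u)
next
  case (plus I J s t y)
  then obtain f g
    where f: "\<And>i. i \<in> I \<Longrightarrow> rounding_factor u (card I - 1) (f i)" "s = (\<Sum>i\<in>I. x i * f i)"
      and g: "\<And>i. i \<in> J \<Longrightarrow> rounding_factor u (card J - 1) (g i)" "t = (\<Sum>i\<in>J. x i * g i)"
    by blast
  obtain d where d: "rounding_factor u 1 d" "y = (s + t) * d"
    using fl_round_factor plus u by metis
  have c: "card (I \<union> J) = card I + card J" "0 < card I" "0 < card J"
    using plus by (auto simp: card_Un_disjoint card_gt_0_iff)
  let ?r = "\<lambda>i. (if i \<in> I then f i else g i) * d"
  have "rounding_factor u (card (I \<union> J) - 1) (?r i)" if "i \<in> I \<union> J" for i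
  proof (cases "i \<in> I")
    case True
    show ?thesis
      using rounding_factor_mono[OF rounding_factor_mult[OF f(1)[OF True] d(1) u(2)] _ u] c True
      by simp
  next
    case False
    then have "i \<in> J" using that by simp
    from rounding_factor_mono[OF rounding_factor_mult[OF g(1)[OF this] d(1) u(2)] _ u] c False
    show ?thesis by simp
  qed
  moreover have "y = (\<Sum>i\<in>I \<union> J. x i * ?r i)"
  proof -
    have "(\<Sum>i\<in>I \<union> J. x i * ?r i) = (\<Sum>i\<in>I. x i * ?r i) + (\<Sum>i\<in>J. x i * ?r i)"
      using plus by (intro sum.union_disjoint) auto
    also have "(\<Sum>i\<in>I. x i * ?r i) = s * d"
      by (simp add: f(2) sum_distrib_right mult.assoc)
    also have "(\<Sum>i\<in>J. x i * ?r i) = t * d"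
      unfolding g(2) sum_distrib_right using plus by (intro sum.cong) auto
    finally show ?thesis by (simp add: d(2) distrib_right)
  qed
  ultimately show ?case
    by (intro exI[of _ ?r]) blast
qed

text \<open>
  The error factor of a distinguished term is pulled out of the whole sum. A term first meets \<open>x c\<close>
  in an addition whose error, like those of all later additions, is common to both and cancels.
  Only the errors before that addition remain in the quotient of their factors, and these are at
  most \<open>card I - 2\<close>: a naive count of the two factors would give about twice as many.
\<close>

lemma fl_sum_factors_distinguished:
  assumes "fl_sum u (image_mset x (mset_set I)) s" "finite I" and "c \<in> I" and u: "0 \<le> u" "u < 1"
  shows "\<exists>q r. rounding_factor u (card I - 1) q \<and>
    (\<forall>i\<in>I - {c}. rounding_factor u (card I - 2) (r i)) \<and>
    s = q * (x c + (\<Sum>i\<in>I - {c}. x i * r i))"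
proof -
  let ?P = "\<lambda>I s. \<exists>q r. rounding_factor u (card I - 1) q \<and>
    (\<forall>i\<in>I - {c}. rounding_factor u (card I - 2) (r i)) \<and>
    s = q * (x c + (\<Sum>i\<in>I - {c}. x i * r i))"
  \<comment> \<open>The distinguished term lies in one of the two summands; by symmetry it may be the first. The
    factor \<open>q\<close> of that summand is pulled out, which divides the factors of the other one by \<open>q\<close>.\<close>
  have step: "?P (I \<union> J) y"
    if IJ: "finite I" "finite J" "I \<noteq> {}" "J \<noteq> {}" "I \<inter> J = {}" and "c \<in> I" and "?P I s"
      and J: "fl_sum u (image_mset x (mset_set J)) t"
      and y: "fl_round u (s + t) y" for I J s t y
  proof -
    obtain g where g: "\<And>i. i \<in> J \<Longrightarrow> rounding_factor u (card J - 1) (g i)" and t: "t = (\<Sum>i\<in>J. x i * g i)"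
      using fl_sum_factors[OF J IJ(2) u] by blast
    from \<open>?P I s\<close> obtain q r where q: "rounding_factor u (card I - 1) q"
      and r: "\<And>i. i \<in> I - {c} \<Longrightarrow> rounding_factor u (card I - 2) (r i)"
      and s: "s = q * (x c + (\<Sum>i\<in>I - {c}. x i * r i))"
      by blast
    obtain d where d: "rounding_factor u 1 d" "y = (s + t) * d"
      using fl_round_factor y u by metis
    have c: "card (I \<union> J) = card I + card J" "0 < card I" "0 < card J"
      using IJ by (auto simp: card_Un_disjoint card_gt_0_iff)
    have q0: "q \<noteq> 0"
      using rounding_factor_pos[OF q u(2)] by simp
    let ?r = "\<lambda>i. if i \<in> I then r i else g i / q"
    have "rounding_factor u (card (I \<union> J) - 1) (q * d)"
      using rounding_factor_mono[OF rounding_factor_mult[OF q d(1) u(2)] _ u] c by simp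
    moreover have "rounding_factor u (card (I \<union> J) - 2) (?r i)" if "i \<in> I \<union> J - {c}" for i
    proof (cases "i \<in> I")
      case True
      then have "i \<in> I - {c}" using that by simp
      from rounding_factor_mono[OF r[OF this] _ u] c True show ?thesis
        by simp
    next
      case False
      then have "i \<in> J" using that by simp
      have "card J - 1 + (card I - 1) \<le> card (I \<union> J) - 2"
        using c by simp
      from rounding_factor_mono[OF rounding_factor_divide[OF g[OF \<open>i \<in> J\<close>] q u(2)] this u] False
      show ?thesis by simp
    qed
    moreover have "y = (q * d) * (x c + (\<Sum>i\<in>I \<union> J - {c}. x i * ?r i))"
    proof -
      have "I \<union> J - {c} = (I - {c}) \<union> J"
        using IJ \<open>c \<in> I\<close> by blast
      then have "(\<Sum>i\<in>I \<union> J - {c}. x i * ?r i) =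
          (\<Sum>i\<in>I - {c}. x i * ?r i) + (\<Sum>i\<in>J. x i * ?r i)"
        using IJ by (simp only:) (intro sum.union_disjoint; blast)
      also have "(\<Sum>i\<in>I - {c}. x i * ?r i) = (\<Sum>i\<in>I - {c}. x i * r i)"
        by (intro sum.cong) auto
      also have "(\<Sum>i\<in>J. x i * ?r i) = t / q"
        unfolding t sum_divide_distrib using IJ by (intro sum.cong) auto
      finally show ?thesis
        using q0 by (simp add: d(2) s field_simps)
    qed
    ultimately show ?thesis
      by (intro exI[of _ "q * d"] exI[of _ ?r]) blast
  qed
  have "c \<in> I \<longrightarrow> ?P I s"
    using assms(1,2)
  proof (induction rule: fl_sum_indexed_induct)
    case (single i)
    show ?case
      using rounding_factor_one[OF u] by (auto intro!: exI[of _ 1])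
  next
    case (plus I J s t y)
    show ?case
      using step[of I J s t y] step[of J I t s y] plus by (auto simp: Un_commute Int_commute add.commute)
  qed
  with \<open>c \<in> I\<close> show ?thesis by blast
qed


text \<open>
  The term \<open>c\<close> is distinguished. It enters the sum without a previous rounding, while the rounding
  of each product accounts for the difference between \<open>card K - 1\<close> and \<open>card K\<close>.
\<close>

lemma fl_residual_factors:
  assumes "fl_residual u c K a b s" "finite K" and u: "0 \<le> u" "u < 1"
  shows "\<exists>q r. rounding_factor u (card K) q \<and> (\<forall>k\<in>K. rounding_factor u (card K) (r k)) \<and>
    s = q * (c - (\<Sum>k\<in>K. a k * b k * r k))"
proof -
  obtain p where p: "\<And>k. k \<in> K \<Longrightarrow> fl_round u (a k * b k) (p k)"
    and s: "fl_sum u (add_mset c (image_mset (\<lambda>k. - p k) (mset_set K))) s"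
    using assms(1) unfolding fl_residual_def by blast
  \<comment> \<open>The index \<open>None\<close> stands for the term \<open>c\<close>.\<close>
  let ?I = "insert None (Some ` K)" and ?x = "case_option c (\<lambda>k. - p k)"
  have "mset_set (Some ` K) = image_mset Some (mset_set K)"
    by (simp add: image_mset_mset_set)
  then have "image_mset ?x (mset_set ?I) = add_mset c (image_mset (\<lambda>k. - p k) (mset_set K))"
    using assms(2) by (simp add: image_mset.compositionality comp_def)
  with s have "fl_sum u (image_mset ?x (mset_set ?I)) s" by simp
  from fl_sum_factors_distinguished[OF this _ _ u, of None] assms(2)
  obtain q r where q: "rounding_factor u (card ?I - 1) q"
    and r: "\<And>i. i \<in> ?I - {None} \<Longrightarrow> rounding_factor u (card ?I - 2) (r i)"
    and s: "s = q * (?x None + (\<Sum>i\<in>?I - {None}. ?x i * r i))"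
    by auto
  have card: "card ?I = card K + 1"
    using assms(2) by (simp add: card_image)
  have I: "?I - {None} = Some ` K" by auto
  have "\<exists>d. rounding_factor u 1 d \<and> p k = a k * b k * d" if "k \<in> K" for k
    using fl_round_factor[OF p[OF that] u] by blast
  then obtain d where d: "\<And>k. k \<in> K \<Longrightarrow> rounding_factor u 1 (d k)"
    "\<And>k. k \<in> K \<Longrightarrow> p k = a k * b k * d k"
    by metis
  have "rounding_factor u (card K) (d k * r (Some k))" if "k \<in> K" for k
  proof -
    have "0 < card K" using that assms(2) by (auto simp: card_gt_0_iff)
    moreover have "rounding_factor u (1 + (card ?I - 2)) (d k * r (Some k))"
      using rounding_factor_mult[OF d(1)[OF that] r u(2)] that by blast
    ultimately show ?thesis using card by simp
  qed
  moreover have "(\<Sum>i\<in>?I - {None}. ?x i * r i) = - (\<Sum>k\<in>K. a k * b k * (d k * r (Some k)))"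
    unfolding I by (simp add: sum.reindex sum_negf d(2) mult.assoc)
  then have "s = q * (c - (\<Sum>k\<in>K. a k * b k * (d k * r (Some k))))"
    using s by simp
  moreover have "rounding_factor u (card K) q"
    using q card by simp
  ultimately show ?thesis
    by (intro exI[of _ q] exI[of _ "\<lambda>k. d k * r (Some k)"]) blast
qed

text \<open>
  The common form of all steps in a triangular factorization or solution: \<open>z\<close> is the last product
  in the relation \<open>(\<Sum>k\<in>K. a k * b k) + z = c\<close> that determines the new entry, for example
  \<open>L $ i $ j * L $ j $ j\<close>, and \<open>t\<close> collects the roundings made after the residual, one for a division
  and two for the square of a square root. Dividing by the common factor \<open>q\<close> of
  the residual leaves \<open>c\<close> unperturbed.
\<close>

lemma fl_residual_backward_error:
  assumes "fl_residual u c K a b s" "finite K" and u: "0 \<le> u" "u < 1"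
    and z: "z = s * t" "rounding_factor u m t" and N: "card K + m \<le> N" "real N * u < 1"
  shows "\<bar>(\<Sum>k\<in>K. a k * b k) + z - c\<bar> \<le> gamma N u * ((\<Sum>k\<in>K. \<bar>a k\<bar> * \<bar>b k\<bar>) + \<bar>z\<bar>)"
proof -
  from fl_residual_factors[OF assms(1,2) u] obtain q r where q: "rounding_factor u (card K) q"
    and r: "\<And>k. k \<in> K \<Longrightarrow> rounding_factor u (card K) (r k)"
    and s: "s = q * (c - (\<Sum>k\<in>K. a k * b k * r k))"
    by blast
  have r': "\<bar>r k - 1\<bar> \<le> gamma N u" if "k \<in> K" for k
    using rounding_factor_gamma[OF rounding_factor_mono[OF r[OF that] _ u] u(1) N(2) u(2)] N(1)
    by simp
  have tq: "rounding_factor u (m + card K) (t * q)"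
    using rounding_factor_mult[OF z(2) q u(2)] .
  have tq': "\<bar>inverse (t * q) - 1\<bar> \<le> gamma N u"
    using rounding_factor_gamma[OF rounding_factor_mono[OF rounding_factor_inverse[OF tq u(2)] _ u]
      u(1) N(2) u(2)] N(1) by simp
  have "0 < t * q" using rounding_factor_pos[OF tq u(2)] .
  moreover have "z = (t * q) * (c - (\<Sum>k\<in>K. a k * b k * r k))"
    by (simp add: z s)
  ultimately have "z * inverse (t * q) = c - (\<Sum>k\<in>K. a k * b k * r k)"
    by (metis divide_inverse less_irrefl nonzero_mult_div_cancel_left)
  then have "(\<Sum>k\<in>K. a k * b k) + z - c =
      - (\<Sum>k\<in>K. a k * b k * (r k - 1)) - z * (inverse (t * q) - 1)"
    by (simp add: right_diff_distrib sum_subtractf)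
  also have "\<bar>\<dots>\<bar> \<le> (\<Sum>k\<in>K. \<bar>a k * b k * (r k - 1)\<bar>) + \<bar>z * (inverse (t * q) - 1)\<bar>"
    using sum_abs[of "\<lambda>k. a k * b k * (r k - 1)" K] by linarith
  also have "\<dots> \<le> (\<Sum>k\<in>K. gamma N u * (\<bar>a k\<bar> * \<bar>b k\<bar>)) + gamma N u * \<bar>z\<bar>"
  proof (intro add_mono sum_mono)
    fix k assume "k \<in> K"
    from mult_left_mono[OF r'[OF this], of "\<bar>a k\<bar> * \<bar>b k\<bar>"]
    show "\<bar>a k * b k * (r k - 1)\<bar> \<le> gamma N u * (\<bar>a k\<bar> * \<bar>b k\<bar>)"
      by (simp add: abs_mult mult.commute)
  next
    from mult_left_mono[OF tq', of "\<bar>z\<bar>"]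
    show "\<bar>z * (inverse (t * q) - 1)\<bar> \<le> gamma N u * \<bar>z\<bar>"
      by (simp add: abs_mult mult.commute)
  qed
  finally show ?thesis
    by (simp add: sum_distrib_left distrib_left)
qed

lemma fl_inner_forward_error:
  assumes "fl_inner u K a b s" "finite K" "K \<noteq> {}" and u: "0 \<le> u" "u < 1" "real (card K) * u < 1"
  shows "\<bar>s - (\<Sum>k\<in>K. a k * b k)\<bar> \<le> gamma (card K) u * (\<Sum>k\<in>K. \<bar>a k\<bar> * \<bar>b k\<bar>)"
proof -
  obtain p where p: "\<And>k. k \<in> K \<Longrightarrow> fl_round u (a k * b k) (p k)"
    and "fl_sum u (image_mset p (mset_set K)) s"
    using assms(1) unfolding fl_inner_def by blast
  from fl_sum_factors[OF this(2) assms(2) u(1,2)]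
  obtain r where r: "\<And>i. i \<in> K \<Longrightarrow> rounding_factor u (card K - 1) (r i)"
    and s: "s = (\<Sum>i\<in>K. p i * r i)"
    by auto
  have "0 < card K" using assms(2,3) by (simp add: card_gt_0_iff)
  have *: "\<bar>p k * r k - a k * b k\<bar> \<le> gamma (card K) u * (\<bar>a k\<bar> * \<bar>b k\<bar>)" if k: "k \<in> K" for k
  proof -
    obtain d where d: "rounding_factor u 1 d" "p k = a k * b k * d"
      using fl_round_factor[OF p[OF k] u(1,2)] by blast
    have "rounding_factor u (card K) (d * r k)"
      using rounding_factor_mult[OF d(1) r[OF k] u(2)] \<open>0 < card K\<close> by simp
    from mult_right_mono[OF rounding_factor_gamma[OF this u(1,3,2)], of "\<bar>a k\<bar> * \<bar>b k\<bar>"]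
    have "\<bar>(d * r k - 1) * (a k * b k)\<bar> \<le> gamma (card K) u * (\<bar>a k\<bar> * \<bar>b k\<bar>)"
      by (simp add: abs_mult)
    also have "(d * r k - 1) * (a k * b k) = p k * r k - a k * b k"
      by (simp add: d(2) algebra_simps)
    finally show ?thesis .
  qed
  have "\<bar>s - (\<Sum>k\<in>K. a k * b k)\<bar> = \<bar>\<Sum>k\<in>K. p k * r k - a k * b k\<bar>"
    by (simp add: s sum_subtractf)
  also have "\<dots> \<le> (\<Sum>k\<in>K. \<bar>p k * r k - a k * b k\<bar>)"
    by (rule sum_abs)
  also have "\<dots> \<le> (\<Sum>k\<in>K. gamma (card K) u * (\<bar>a k\<bar> * \<bar>b k\<bar>))"
    using * by (rule sum_mono)
  finally show ?thesis by (simp add: sum_distrib_left)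
qed

section \<open>Triangular factors\<close>

lemma transpose_eq_entry: "transpose M = M \<Longrightarrow> M $ i $ j = M $ j $ i"
  by (metis transpose_def vec_lambda_beta)

lemma sum_zero_above:
  fixes g :: "'n::{finite,linorder} \<Rightarrow> real"
  assumes "\<And>k. j < k \<Longrightarrow> g k = 0"
  shows "sum g UNIV = sum g {k. k < j} + g j"
proof -
  have "sum g UNIV = sum g (insert j {k. k < j})"
    using assms by (intro sum.mono_neutral_right) (auto, meson not_less_iff_gr_or_eq)
  then show ?thesis by simp
qed

lemma card_less_CARD: "card {k. k < (j::'n::{finite,linorder})} < CARD('n)"
  by (rule psubset_card_mono) auto

text \<open>The divisions by diagonal entries can therefore be undone by a multiplication.\<close>

lemma fl_cholesky_diag_nonzero:
  assumes "fl_cholesky u M L" "0 \<le> u" "u < 1"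
  shows "L $ j $ j \<noteq> 0"
proof -
  obtain s where "0 < s" "fl_round u (sqrt s) (L $ j $ j)"
    using assms(1) unfolding fl_cholesky_def by blast
  moreover from this(2) obtain r where "rounding_factor u 1 r" "L $ j $ j = sqrt s * r"
    using fl_round_factor assms by blast
  ultimately show ?thesis
    using rounding_factor_pos[of u 1 r] assms by simp
qed

text \<open>
  At most \<open>n - 1\<close> products are subtracted for an entry. The index \<open>n + 1\<close> is due to the diagonal,
  where the square root is squared. Only the lower triangle of \<open>M\<close> is read; the symmetry of \<open>M\<close>
  transfers the bound to the upper one.
\<close>

lemma fl_cholesky_backward_error:
  fixes M L :: "('n::{finite,linorder}) sqmat"
  assumes chol: "fl_cholesky u M L" and sym: "transpose M = M"
    and u: "0 \<le> u" "real (CARD('n) + 1) * u < 1"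
  shows "\<bar>(\<Sum>k\<in>UNIV. L $ i $ k * L $ j $ k) - M $ i $ j\<bar> \<le>
    gamma (CARD('n) + 1) u * (\<Sum>k\<in>UNIV. \<bar>L $ i $ k\<bar> * \<bar>L $ j $ k\<bar>)"
proof -
  have "1 * u \<le> real (CARD('n) + 1) * u"
    using u(1) by (intro mult_right_mono) auto
  then have u1: "u < 1" using u(2) by linarith
  have lower: "\<bar>(\<Sum>k\<in>UNIV. L $ i $ k * L $ j $ k) - M $ i $ j\<bar> \<le>
    gamma (CARD('n) + 1) u * (\<Sum>k\<in>UNIV. \<bar>L $ i $ k\<bar> * \<bar>L $ j $ k\<bar>)" if "j \<le> i" for i j
  proof -
    have zero: "L $ j $ k = 0" if "j < k" for k
      using chol that by (simp add: fl_cholesky_def lower_triangular_def)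
    have "\<exists>s t m. fl_residual u (M $ i $ j) {k. k < j} (\<lambda>k. L $ i $ k) (\<lambda>k. L $ j $ k) s \<and>
        L $ i $ j * L $ j $ j = s * t \<and> rounding_factor u m t \<and> m \<le> 2"
    proof (cases "i = j")
      case True
      obtain s where s: "fl_residual u (M $ j $ j) {k. k < j} (\<lambda>k. L $ j $ k) (\<lambda>k. L $ j $ k) s"
        "0 < s" "fl_round u (sqrt s) (L $ j $ j)"
        using chol unfolding fl_cholesky_def by blast
      obtain r where r: "rounding_factor u 1 r" "L $ j $ j = sqrt s * r"
        using fl_round_factor[OF s(3) u(1) u1] by blast
      have "L $ j $ j * L $ j $ j = (sqrt s * sqrt s) * (r * r)"
        by (simp add: r(2))
      also have "sqrt s * sqrt s = s"
        using s(2) by simp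
      finally show ?thesis
        using s(1) rounding_factor_mult[OF r(1) r(1) u1] True
        by (intro exI[of _ s] exI[of _ "r * r"] exI[of _ "1 + 1"]) simp
    next
      case False
      with \<open>j \<le> i\<close> have "j < i" by simp
      then obtain s where s: "fl_residual u (M $ i $ j) {k. k < j} (\<lambda>k. L $ i $ k) (\<lambda>k. L $ j $ k) s"
        "fl_round u (s / L $ j $ j) (L $ i $ j)"
        using chol unfolding fl_cholesky_def by blast
      obtain r where r: "rounding_factor u 1 r" "L $ i $ j = s / L $ j $ j * r"
        using fl_round_factor[OF s(2) u(1) u1] by blast
      have "L $ i $ j * L $ j $ j = s * r"
        using r(2) fl_cholesky_diag_nonzero[OF chol u(1) u1, of j] by simp
      with s(1) r(1) show ?thesis
        by (intro exI[of _ s] exI[of _ r] exI[of _ 1]) simp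
    qed
    then obtain s t m where stm:
      "fl_residual u (M $ i $ j) {k. k < j} (\<lambda>k. L $ i $ k) (\<lambda>k. L $ j $ k) s"
      "L $ i $ j * L $ j $ j = s * t" "rounding_factor u m t" "m \<le> 2"
      by blast
    have "card {k. k < j} + m \<le> CARD('n) + 1"
      using card_less_CARD[of j] stm(4) by linarith
    from fl_residual_backward_error[OF stm(1) _ u(1) u1 stm(2,3) this u(2)]
    show ?thesis
      by (subst (1 2) sum_zero_above[of j]) (auto simp: zero abs_mult)
  qed
  have "M $ i $ j = M $ j $ i"
    using sym by (rule transpose_eq_entry)
  then show ?thesis
    using lower[of i j] lower[of j i] by (cases "j \<le> i") (auto simp: mult.commute)
qed

lemma bij_rev_index: "bij (rev_index :: 'n::{finite,linorder} \<Rightarrow> 'n)"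
proof -
  have "inj (rev_index :: 'n \<Rightarrow> 'n)"
  proof (rule injI)
    fix i j :: 'n assume "rev_index i = rev_index j"
    then show "i = j"
      using rev_index_strict_antimono[of i j] rev_index_strict_antimono[of j i]
      by (cases i j rule: linorder_cases) auto
  qed
  then show ?thesis
    by (simp add: bij_def finite_UNIV_inj_surj)
qed

text \<open>
  Conjugation with the reversal only renumbers rows and columns, hence involves no rounding and
  carries the Cholesky error bound over to the reverse factorization.
\<close>

lemma rev_identity_conj_left:
  "(transpose rev_identity ** M ** rev_identity) $ i $ j = M $ rev_index i $ rev_index j"
  by (simp add: matrix_matrix_mult_def transpose_def rev_identity_def mat_def if_distrib if_distribR
      cong: if_cong)

lemma rev_identity_conj_right:
  fixes L :: "('n::{finite,linorder}) sqmat"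
  shows "(rev_identity ** L ** transpose rev_identity) $ rev_index i $ rev_index j = L $ i $ j"
proof -
  have "rev_index i = rev_index k \<longleftrightarrow> i = k" for i k :: 'n
    using bij_rev_index by (metis bij_def injD)
  then show ?thesis
    by (simp add: matrix_matrix_mult_def transpose_def rev_identity_def mat_def if_distrib if_distribR
      cong: if_cong)
qed

lemma fl_rev_cholesky_backward_error:
  fixes M U :: "('n::{finite,linorder}) sqmat"
  assumes chol: "fl_rev_cholesky u M U" and sym: "transpose M = M"
    and u: "0 \<le> u" "real (CARD('n) + 1) * u < 1"
  shows "\<bar>(\<Sum>k\<in>UNIV. U $ i $ k * U $ j $ k) - M $ i $ j\<bar> \<le>
    gamma (CARD('n) + 1) u * (\<Sum>k\<in>UNIV. \<bar>U $ i $ k\<bar> * \<bar>U $ j $ k\<bar>)"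
proof -
  let ?M = "transpose rev_identity ** M ** rev_identity"
  obtain L where L: "fl_cholesky u ?M L" "U = rev_identity ** L ** transpose rev_identity"
    using chol unfolding fl_rev_cholesky_def by blast
  have "transpose ?M = ?M"
    using sym by (simp add: matrix_transpose_mul matrix_mul_assoc)
  note bound = fl_cholesky_backward_error[OF L(1) this u]
  obtain a b where ab: "i = rev_index a" "j = rev_index b"
    using bij_rev_index by (metis bij_pointE)
  have reindex: "(\<Sum>k\<in>UNIV. g k) = (\<Sum>k\<in>UNIV. g (rev_index k))" for g :: "'n \<Rightarrow> real"
    using sum.reindex_bij_betw[OF bij_rev_index, of g] by simp
  have U: "U $ rev_index a $ rev_index b = L $ a $ b" for a b
    unfolding L(2) by (rule rev_identity_conj_right)
  show ?thesis
    using bound[of a b] reindex[of "\<lambda>k. U $ i $ k * U $ j $ k"]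
      reindex[of "\<lambda>k. \<bar>U $ i $ k\<bar> * \<bar>U $ j $ k\<bar>"]
    by (simp add: ab U rev_identity_conj_left)
qed

lemma fl_forward_subst_backward_error:
  fixes L :: "('n::{finite,linorder}) sqmat"
  assumes subst: "fl_forward_subst u L B X"
    and L: "lower_triangular L" "\<And>i. L $ i $ i \<noteq> 0"
    and u: "0 \<le> u" "real CARD('n) * u < 1"
  shows "\<bar>(\<Sum>k\<in>UNIV. L $ i $ k * X $ k $ j) - B $ i $ j\<bar> \<le>
    gamma CARD('n) u * (\<Sum>k\<in>UNIV. \<bar>L $ i $ k\<bar> * \<bar>X $ k $ j\<bar>)"
proof -
  have "1 * u \<le> real CARD('n) * u"
    using u(1) by (intro mult_right_mono) auto
  then have u1: "u < 1" using u(2) by linarith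
  obtain s where s: "fl_residual u (B $ i $ j) {k. k < i} (\<lambda>k. L $ i $ k) (\<lambda>k. X $ k $ j) s"
    "fl_round u (s / L $ i $ i) (X $ i $ j)"
    using subst unfolding fl_forward_subst_def by blast
  obtain r where r: "rounding_factor u 1 r" "X $ i $ j = s / L $ i $ i * r"
    using fl_round_factor[OF s(2) u(1) u1] by blast
  have z: "L $ i $ i * X $ i $ j = s * r"
    using r(2) L(2)[of i] by simp
  have zero: "L $ i $ k = 0" if "i < k" for k
    using L(1) that by (simp add: lower_triangular_def)
  have "card {k. k < i} + 1 \<le> CARD('n)"
    using card_less_CARD[of i] by simp
  from fl_residual_backward_error[OF s(1) _ u(1) u1 z r(1) this u(2)]
  show ?thesis
    by (subst (1 2) sum_zero_above[of i]) (auto simp: zero abs_mult)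
qed

section \<open>Entries of the block factor\<close>

lemma sum_UNIV_sum_type:
  fixes g :: "'a::finite + 'b::finite \<Rightarrow> real"
  shows "sum g UNIV = (\<Sum>a\<in>UNIV. g (Inl a)) + (\<Sum>b\<in>UNIV. g (Inr b))"
  by (simp add: sum.Plus comp_def flip: UNIV_Plus_UNIV)

text \<open>
  The relative error of the subtraction applies to \<open>D - C\<close>. Its part on \<open>D\<close> is the term
  \<open>u * \<bar>D $ i $ j\<bar>\<close>; its part on the computed product \<open>C\<close> merges with the error of the product.
\<close>

lemma fl_schur_complement_error:
  fixes B :: "real^'k^'n" and D C S :: "real^'n^'n"
  assumes mult: "fl_matrix_mult u B (transpose B) C" and minus: "fl_matrix_minus u D C S"
    and u: "0 \<le> u" "real (CARD('k) + 1) * u < 1"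
  shows "\<bar>(\<Sum>k\<in>UNIV. B $ i $ k * B $ j $ k) + S $ i $ j - D $ i $ j\<bar> \<le>
    u * \<bar>D $ i $ j\<bar> + gamma (CARD('k) + 1) u * (\<Sum>k\<in>UNIV. \<bar>B $ i $ k\<bar> * \<bar>B $ j $ k\<bar>)"
proof -
  let ?g = "gamma CARD('k) u"
  define P where "P = (\<Sum>k\<in>UNIV. B $ i $ k * B $ j $ k)"
  define Q where "Q = (\<Sum>k\<in>UNIV. \<bar>B $ i $ k\<bar> * \<bar>B $ j $ k\<bar>)"
  have "1 * u \<le> real (CARD('k) + 1) * u" "real CARD('k) * u \<le> real (CARD('k) + 1) * u"
    using u(1) by (intro mult_right_mono; simp)+
  then have u1: "u < 1" "real CARD('k) * u < 1" using u(2) by linarith+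
  have "fl_inner u UNIV (\<lambda>k. B $ i $ k) (\<lambda>k. B $ j $ k) (C $ i $ j)"
    using mult by (simp add: fl_matrix_mult_def transpose_def)
  from fl_inner_forward_error[OF this _ _ u(1) u1] have C: "\<bar>C $ i $ j - P\<bar> \<le> ?g * Q"
    by (simp add: P_def Q_def)
  obtain d where d: "\<bar>d\<bar> \<le> u" "S $ i $ j = (D $ i $ j - C $ i $ j) * (1 + d)"
    using minus unfolding fl_matrix_minus_def fl_round_def by blast
  have "\<bar>P\<bar> \<le> Q"
    unfolding P_def Q_def by (rule order_trans[OF sum_abs]) (simp add: abs_mult)
  have "Q \<ge> 0"
    unfolding Q_def by (intro sum_nonneg) auto
  have "\<bar>(D $ i $ j - C $ i $ j) * d\<bar> \<le> (\<bar>D $ i $ j\<bar> + \<bar>C $ i $ j\<bar>) * u"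
    unfolding abs_mult using d(1) by (intro mult_mono) auto
  also have "\<dots> \<le> (\<bar>D $ i $ j\<bar> + (Q + ?g * Q)) * u"
    using C \<open>\<bar>P\<bar> \<le> Q\<close> u(1) by (intro mult_right_mono) linarith+
  finally have "\<bar>(D $ i $ j - C $ i $ j) * d\<bar> \<le> u * \<bar>D $ i $ j\<bar> + (u * (1 + ?g)) * Q"
    by (simp add: algebra_simps)
  moreover have "P + S $ i $ j - D $ i $ j = (P - C $ i $ j) + (D $ i $ j - C $ i $ j) * d"
    by (simp add: d(2) algebra_simps)
  ultimately have "\<bar>P + S $ i $ j - D $ i $ j\<bar> \<le> u * \<bar>D $ i $ j\<bar> + (?g + u * (1 + ?g)) * Q"
    using C by (simp add: distrib_right)
  also have "\<dots> \<le> u * \<bar>D $ i $ j\<bar> + gamma (CARD('k) + 1) u * Q"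
    using gamma_add_le[OF u] \<open>Q \<ge> 0\<close> by (intro add_left_mono mult_right_mono)
  finally show ?thesis
    by (simp add: P_def Q_def)
qed

text \<open>
  The four blocks are treated separately. In the last one, the error with respect to \<open>A22\<close> is the
  sum of the errors of the Schur complement and of its reverse factorization.
\<close>

lemma fl_algorithm_W2_entrywise_error:
  fixes A L :: "real^('n::{finite,linorder} + 'n)^('n + 'n)"
  assumes sym: "transpose A = A" and W2: "fl_algorithm_W2 u A L"
    and u: "0 \<le> u" "real (CARD('n) + 1) * u < 1"
  shows "\<bar>L ** transpose L - A\<bar> \<le>
    u *\<^sub>R \<bar>A\<bar> + gamma (CARD('n) + 1) u *\<^sub>R (\<bar>L\<bar> ** \<bar>transpose L\<bar>)"
proof -
  let ?g = "gamma (CARD('n) + 1) u"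
  obtain A11 A12 A22 L11 L21 C S U where
    A: "A = block_matrix A11 A12 (transpose A12) A22" and
    chol: "fl_cholesky u A11 L11" and
    subst: "fl_forward_subst u L11 A12 (transpose L21)" and
    mult: "fl_matrix_mult u L21 (transpose L21) C" and
    minus: "fl_matrix_minus u A22 C S" and
    S: "transpose S = S" and
    rev: "fl_rev_cholesky u S U" and
    L: "L = block_matrix L11 0 L21 U"
    using W2 unfolding fl_algorithm_W2_def by blast
  have "1 * u \<le> real (CARD('n) + 1) * u" "real CARD('n) * u \<le> real (CARD('n) + 1) * u"
    using u(1) by (intro mult_right_mono; simp)+
  then have u1: "u < 1" "real CARD('n) * u < 1" using u(2) by linarith+
  have g: "gamma CARD('n) u \<le> ?g"
    using gamma_add_le[OF u] mult_nonneg_nonneg[OF u(1) gamma_nonneg[OF u(1) u1(2)]] u(1)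
    by (simp add: distrib_left)
  have Aswap: "A $ x $ y = A $ y $ x" for x y
    using sym by (rule transpose_eq_entry)
  have A11: "transpose A11 = A11"
  proof -
    have "A11 $ a $ b = A11 $ b $ a" for a b
      using Aswap[of "Inl a" "Inl b"] by (simp add: A block_matrix_def)
    then show ?thesis by (simp add: vec_eq_iff transpose_def)
  qed
  let ?err = "\<lambda>x y. \<bar>(\<Sum>k\<in>UNIV. L $ x $ k * L $ y $ k) - A $ x $ y\<bar>"
  let ?bd = "\<lambda>x y. u * \<bar>A $ x $ y\<bar> + ?g * (\<Sum>k\<in>UNIV. \<bar>L $ x $ k\<bar> * \<bar>L $ y $ k\<bar>)"
  have weaken: "?err x y \<le> ?bd x y"
    if "?err x y \<le> ?g * (\<Sum>k\<in>UNIV. \<bar>L $ x $ k\<bar> * \<bar>L $ y $ k\<bar>)" for x y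
  proof -
    have "0 \<le> u * \<bar>A $ x $ y\<bar>" using u(1) by simp
    then show ?thesis using that by (rule add_increasing)
  qed
  have 11: "?err (Inl a) (Inl b) \<le> ?bd (Inl a) (Inl b)" for a b
    using fl_cholesky_backward_error[OF chol A11 u, of a b]
    by (intro weaken) (simp add: sum_UNIV_sum_type L A block_matrix_def)
  have 12: "?err (Inl a) (Inr b) \<le> ?bd (Inl a) (Inr b)" for a b
  proof -
    have "lower_triangular L11"
      using chol by (simp add: fl_cholesky_def)
    note fl_forward_subst_backward_error[OF subst this fl_cholesky_diag_nonzero[OF chol u(1) u1(1)]
        u(1) u1(2), of a b]
    also have "gamma CARD('n) u * (\<Sum>k\<in>UNIV. \<bar>L11 $ a $ k\<bar> * \<bar>transpose L21 $ k $ b\<bar>) \<le>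
        ?g * (\<Sum>k\<in>UNIV. \<bar>L11 $ a $ k\<bar> * \<bar>transpose L21 $ k $ b\<bar>)"
      using g by (intro mult_right_mono sum_nonneg) auto
    finally show ?thesis
      by (intro weaken) (simp add: sum_UNIV_sum_type L A block_matrix_def transpose_def)
  qed
  have 21: "?err (Inr a) (Inl b) \<le> ?bd (Inr a) (Inl b)" for a b
    using 12[of b a] Aswap[of "Inr a" "Inl b"] by (simp add: mult.commute)
  have 22: "?err (Inr a) (Inr b) \<le> ?bd (Inr a) (Inr b)" for a b
    using fl_schur_complement_error[OF mult minus u, of a b]
      fl_rev_cholesky_backward_error[OF rev S u, of a b]
    by (simp add: sum_UNIV_sum_type L A block_matrix_def distrib_left)
  have "?err x y \<le> ?bd x y" for x y
    using 11 12 21 22 by (cases x; cases y) blast+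
  then show ?thesis
    by (simp add: less_eq_vec_def abs_vec_def matrix_matrix_mult_def transpose_def)
qed

section \<open>Normwise bound\<close>

lemma norm_le_card_bound:
  fixes x :: "real^'n"
  assumes "\<And>i. \<bar>x $ i\<bar> \<le> m"
  shows "norm x \<le> sqrt (real CARD('n)) * m"
proof -
  have "0 \<le> m" using assms by (meson abs_ge_zero order_trans)
  have "norm x \<le> norm (\<chi> i. m :: real^'n)"
    using assms \<open>0 \<le> m\<close> by (intro norm_le_componentwise_cart) auto
  also have "\<dots> = sqrt (real CARD('n)) * m"
    using \<open>0 \<le> m\<close> by (simp add: norm_vec_def L2_set_def real_sqrt_mult)
  finally show ?thesis .
qed

text \<open>
  Each row, and then the product with a unit vector, has a Euclidean norm of at most
  \<open>sqrt n\<close> times its largest entry.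
\<close>

lemma spectral_norm_le_card_bound:
  fixes B :: "real^'n^'n"
  assumes "\<And>i j. \<bar>B $ i $ j\<bar> \<le> m"
  shows "spectral_norm B \<le> real CARD('n) * m"
  unfolding spectral_norm_def
proof (rule onorm_le)
  fix x :: "real^'n"
  have "\<bar>(B *v x) $ i\<bar> \<le> sqrt (real CARD('n)) * m * norm x" for i
  proof -
    have "\<bar>(B *v x) $ i\<bar> \<le> norm (B $ i) * norm x"
      using Cauchy_Schwarz_ineq2[of "B $ i" x] by (simp add: matrix_vector_mul_component)
    also have "\<dots> \<le> sqrt (real CARD('n)) * m * norm x"
      using norm_le_card_bound[of "B $ i" m] assms by (intro mult_right_mono) auto
    finally show ?thesis .
  qed
  from norm_le_card_bound[OF this] show "norm (B *v x) \<le> real CARD('n) * m * norm x"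
    by (simp add: mult.assoc[symmetric])
qed

text \<open>
  An entry of \<open>\<bar>L\<bar> ** \<bar>transpose L\<bar>\<close> is at most the mean of two diagonal entries of
  \<open>L ** transpose L\<close>, where taking absolute values changes nothing.
\<close>

lemma gram_abs_entry_le_spectral_norm:
  fixes L :: "real^'n^'n"
  shows "(\<bar>L\<bar> ** \<bar>transpose L\<bar>) $ i $ j \<le> spectral_norm (L ** transpose L)"
proof -
  have diag: "(\<Sum>k\<in>UNIV. (L $ i $ k)\<^sup>2) \<le> spectral_norm (L ** transpose L)" for i
    using matrix_component_le_onorm[of "L ** transpose L" i i]
    by (simp add: spectral_norm_def matrix_matrix_mult_def transpose_def power2_eq_square)
  have "(\<bar>L\<bar> ** \<bar>transpose L\<bar>) $ i $ j = (\<Sum>k\<in>UNIV. \<bar>L $ i $ k\<bar> * \<bar>L $ j $ k\<bar>)"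
    by (simp add: abs_vec_def matrix_matrix_mult_def transpose_def)
  also have "\<dots> \<le> (\<Sum>k\<in>UNIV. ((L $ i $ k)\<^sup>2 + (L $ j $ k)\<^sup>2) / 2)"
  proof (rule sum_mono)
    fix k
    show "\<bar>L $ i $ k\<bar> * \<bar>L $ j $ k\<bar> \<le> ((L $ i $ k)\<^sup>2 + (L $ j $ k)\<^sup>2) / 2"
      using sum_squares_bound[of "\<bar>L $ i $ k\<bar>" "\<bar>L $ j $ k\<bar>"] by simp
  qed
  also have "\<dots> = ((\<Sum>k\<in>UNIV. (L $ i $ k)\<^sup>2) + (\<Sum>k\<in>UNIV. (L $ j $ k)\<^sup>2)) / 2"
    by (simp add: sum.distrib flip: sum_divide_distrib)
  also have "\<dots> \<le> (spectral_norm (L ** transpose L) + spectral_norm (L ** transpose L)) / 2"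
    using diag by (intro divide_right_mono add_mono) auto
  finally show ?thesis by simp
qed

lemma spectral_norm_nonneg: "0 \<le> spectral_norm B"
  unfolding spectral_norm_def by (rule onorm_pos_le[OF matrix_vector_mul_bounded_linear])

lemma spectral_norm_add: "spectral_norm (B + C) \<le> spectral_norm B + spectral_norm C"
  unfolding spectral_norm_def matrix_vector_mult_add_rdistrib
  by (rule onorm_triangle) (rule matrix_vector_mul_bounded_linear)+

lemma spectral_norm_minus: "spectral_norm (- B) = spectral_norm B"
proof -
  have "(*v) (- B) = (\<lambda>x. - (B *v x))"
    by (rule ext) (simp add: matrix_vector_mult_def vec_eq_iff sum_negf)
  then show ?thesis
    by (simp add: spectral_norm_def onorm_neg)
qed

text \<open>
  The entrywise bound refers to the computed \<open>L\<close>, whose size is known only through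
  \<open>L ** transpose L = B + E\<close>. The resulting inequality for the norm of \<open>E\<close> is implicit, and the
  assumption on \<open>g\<close> allows solving it.
\<close>

lemma spectral_norm_gram_error:
  fixes B L :: "real^'n^'n"
  assumes bound: "\<bar>L ** transpose L - B\<bar> \<le> u *\<^sub>R \<bar>B\<bar> + g *\<^sub>R (\<bar>L\<bar> ** \<bar>transpose L\<bar>)"
    and "0 \<le> u" "0 \<le> g" "2 * real CARD('n) * g \<le> 1"
  shows "spectral_norm (L ** transpose L - B) \<le> 2 * real CARD('n) * (u + g) * spectral_norm B"
proof -
  let ?E = "L ** transpose L - B"
  let ?a = "spectral_norm B" and ?e = "spectral_norm ?E" and ?N = "real CARD('n)"
  have "spectral_norm (L ** transpose L) \<le> ?a + ?e"
    using spectral_norm_add[of B ?E] by simp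
  then have gram: "(\<bar>L\<bar> ** \<bar>transpose L\<bar>) $ i $ j \<le> ?a + ?e" for i j
    using gram_abs_entry_le_spectral_norm[of L i j] by linarith
  have "\<bar>?E $ i $ j\<bar> \<le> u * ?a + g * (?a + ?e)" for i j
  proof -
    have "\<bar>?E $ i $ j\<bar> \<le> u * \<bar>B $ i $ j\<bar> + g * (\<bar>L\<bar> ** \<bar>transpose L\<bar>) $ i $ j"
      using bound by (simp add: less_eq_vec_def abs_vec_def)
    also have "\<dots> \<le> u * ?a + g * (?a + ?e)"
      using assms(2,3) gram matrix_component_le_onorm[of B i j]
      by (intro add_mono mult_left_mono) (auto simp: spectral_norm_def)
    finally show ?thesis .
  qed
  from spectral_norm_le_card_bound[OF this]
  have "?e \<le> ?N * (u + g) * ?a + ?N * g * ?e"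
    by (simp add: algebra_simps)
  also have "?N * g * ?e \<le> 1 / 2 * ?e"
    using assms(4) spectral_norm_nonneg by (intro mult_right_mono) auto
  finally show ?thesis by simp
qed

theorem theorem3p8:
  fixes A L2 :: "real^('n::{finite,linorder} + 'n)^('n + 'n)" and u :: real
  assumes "sym_pos_def A"
    and "0 < u" and "real (CARD('n) + 1) * u < 1"
    and "fl_algorithm_W2 u A L2"
  shows "\<exists>E. A + E = L2 ** transpose L2 \<and>
           \<bar>E\<bar> \<le> u *\<^sub>R \<bar>A\<bar> + gamma (CARD('n) + 1) u *\<^sub>R (\<bar>L2\<bar> ** \<bar>transpose L2\<bar>) \<and>
           (real (CARD('n) + 2) * u < 1 \<and> 4 * real CARD('n) * gamma (CARD('n) + 2) u < 1 \<longrightarrow>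
              spectral_norm (A - L2 ** transpose L2) = spectral_norm E \<and>
              spectral_norm E \<le> 4 * real CARD('n) * gamma (CARD('n) + 2) u * spectral_norm A)"
proof (intro exI conjI impI)
  let ?E = "L2 ** transpose L2 - A" and ?g = "gamma (CARD('n) + 1) u"
  have sym: "transpose A = A"
    using assms(1) by (simp add: sym_pos_def_def)
  show "A + ?E = L2 ** transpose L2" by simp
  show bound: "\<bar>?E\<bar> \<le> u *\<^sub>R \<bar>A\<bar> + ?g *\<^sub>R (\<bar>L2\<bar> ** \<bar>transpose L2\<bar>)"
    using fl_algorithm_W2_entrywise_error[OF sym assms(4)] assms(2,3) by simp
  show "spectral_norm (A - L2 ** transpose L2) = spectral_norm ?E"
    using spectral_norm_minus[of ?E] by simp
  assume small: "real (CARD('n) + 2) * u < 1 \<and> 4 * real CARD('n) * gamma (CARD('n) + 2) u < 1"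
  have g: "0 \<le> ?g"
    using assms(2,3) by (intro gamma_nonneg) auto
  have "?g + u * (1 + ?g) \<le> gamma (CARD('n) + 2) u"
    using gamma_add_le[of u "CARD('n) + 1"] assms(2) small by (simp add: add.commute)
  then have le: "u + ?g \<le> gamma (CARD('n) + 2) u"
    using mult_nonneg_nonneg[OF _ g, of u] assms(2) by (simp add: distrib_left)
  have card: "real CARD('n + 'n) = 2 * real CARD('n)" by simp
  have "4 * real CARD('n) * ?g \<le> 4 * real CARD('n) * gamma (CARD('n) + 2) u"
    using le assms(2) by (intro mult_left_mono) linarith+
  also have "\<dots> \<le> 1"
    using small by simp
  finally have "2 * real CARD('n + 'n) * ?g \<le> 1"
    using card by simp
  from spectral_norm_gram_error[OF bound _ g this] assms(2)
  have "spectral_norm ?E \<le> 4 * real CARD('n) * (u + ?g) * spectral_norm A"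
    by simp
  also have "\<dots> \<le> 4 * real CARD('n) * gamma (CARD('n) + 2) u * spectral_norm A"
    using le spectral_norm_nonneg by (intro mult_right_mono mult_left_mono) auto
  finally show "spectral_norm ?E \<le> 4 * real CARD('n) * gamma (CARD('n) + 2) u * spectral_norm A" .
qed

end
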